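(* Consider the one-step linear feedback family $$Y_{t+1}=\mu(H_t)+\beta A_t+\varepsilon_{t+1},\qquad \mathbb{E}[\varepsilon_{t+1}\mid H_t,A_t]=0,$$ with squared loss and finite second moments. In the passive regime $A_t=0$. Fix any forecaster $f$ and deployment policy $A_t=\pi_f(H_t)$ satisfying $\mathbb{E}[\pi_f(H_t)^2]>0$ under the passive history law. Then all values of $\beta$ induce the same passive distribution over $(H_t,Y_{t+1})$, but the one-step deployment risk of $f$ is a nonconstant quadratic function of $\beta$. Consequently, no estimator based only on passive histories can identify deployment risk uniformly over this family.
   Context: $H_t$ is the observed history at time $t$ (past outcomes and actions, up to and including the time-$t$ outcome but before the time-$t$ action), $Y_{t+1}$ is the real-valued next outcome, $A_t$ is the real-valued action taken at time $t$ after $H_t$ is observed, $\varepsilon_{t+1}$ is noise, $\mu$ is a real-valued function of the history, and $\beta\in\mathbb{R}$ is the feedback coefficient indexing the family. A forecaster $f$ maps histories to predictions, predicting $Y_{t+1}$ by $f(H_t)$. A deployment policy $\pi_f$ maps the history to the action induced by deploying $f$. The passive regime is the one in which $A_t=0$; the passive history law is the law of $H_t$ in this regime, the passive distribution is the joint law of $(H_t,Y_{t+1})$ in this regime, and passive histories are data generated in this regime. The one-step deployment risk of $f$ under squared loss is $$\mathbb{E}_{H_t}\Big[\mathbb{E}\big[(f(H_t)-Y_{t+1})^2\,\big|\,H_t,\,A_t=\pi_f(H_t)\big]\Big],$$ where the outer expectation draws $H_t$ from the passive history law and only the time-$t$ action is induced by the deployment policy. An estimator based only on passive histories is a measurable function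 of passive histories only. *)

theory Defs
  imports "HOL-Probability.Probability"
begin

text \<open>
  Histories \<open>H\<^sub>t\<close> live in an arbitrary measurable space, and \<open>P\<close> is their law in the passive regime.
  The noise is described by a probability kernel: \<open>K (h, a)\<close> is the law of the noise given
  \<open>H\<^sub>t = h\<close> and \<open>A\<^sub>t = a\<close>. The noise may therefore depend on the history and on the action.
  The feedback coefficient \<open>\<beta>\<close> enters only the outcome equation.
\<close>

text \<open>
  Joint law of \<open>(H\<^sub>t, A\<^sub>t, \<epsilon>\<^sub>t\<^sub>+\<^sub>1)\<close> when \<open>H\<^sub>t\<close> follows the passive history law and the time-\<open>t\<close>
  action is \<open>A\<^sub>t = g H\<^sub>t\<close>. The passive regime is \<open>g = (\<lambda>_. 0)\<close>; deploying a forecaster is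
  \<open>g = \<pi>\<close> for the deployment policy \<open>\<pi>\<close>.
\<close>

definition regime ::
    "'h measure \<Rightarrow> ('h \<times> real \<Rightarrow> real measure) \<Rightarrow> ('h \<Rightarrow> real) \<Rightarrow> ('h \<times> real \<times> real) measure"
  where "regime P K g =
    P \<bind> (\<lambda>h. distr (K (h, g h)) (P \<Otimes>\<^sub>M borel \<Otimes>\<^sub>M borel) (\<lambda>e. (h, g h, e)))"

definition sigma_HA ::
    "'h measure \<Rightarrow> ('h \<times> real \<times> real) measure \<Rightarrow> ('h \<times> real \<times> real) measure"
  where "sigma_HA P R = vimage_algebra (space R) (\<lambda>(h, a, e). (h, a)) (P \<Otimes>\<^sub>M borel)"

text \<open>
  \<open>E[\<epsilon>\<^sub>t\<^sub>+\<^sub>1 | H\<^sub>t, A\<^sub>t] = 0\<close> almost surely, and \<open>\<epsilon>\<^sub>t\<^sub>+\<^sub>1\<close> has a finite second moment. The latter makes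
  the conditional expectation the genuine one.
\<close>

definition centered_noise ::
    "'h measure \<Rightarrow> ('h \<times> real \<Rightarrow> real measure) \<Rightarrow> ('h \<Rightarrow> real) \<Rightarrow> bool"
  where "centered_noise P K g \<longleftrightarrow>
    integrable (regime P K g) (\<lambda>(h, a, e). e\<^sup>2) \<and>
    (AE w in regime P K g.
       real_cond_exp (regime P K g) (sigma_HA P (regime P K g)) (\<lambda>(h, a, e). e) w = 0)"

definition outcome :: "('h \<Rightarrow> real) \<Rightarrow> real \<Rightarrow> 'h \<times> real \<times> real \<Rightarrow> real"
  where "outcome \<mu> \<beta> = (\<lambda>(h, a, e). \<mu> h + \<beta> * a + e)"

definition passive_dist ::
    "'h measure \<Rightarrow> ('h \<times> real \<Rightarrow> real measure) \<Rightarrow> ('h \<Rightarrow> real) \<Rightarrow> real \<Rightarrow> ('h \<times> real) measure"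
  where "passive_dist P K \<mu> \<beta> =
    distr (regime P K (\<lambda>_. 0)) (P \<Otimes>\<^sub>M borel) (\<lambda>w. (fst w, outcome \<mu> \<beta> w))"

text \<open>Conditional law of \<open>Y\<^sub>t\<^sub>+\<^sub>1\<close> given \<open>H\<^sub>t = h\<close> and \<open>A\<^sub>t = a\<close>.\<close>

definition outcome_law ::
    "('h \<times> real \<Rightarrow> real measure) \<Rightarrow> ('h \<Rightarrow> real) \<Rightarrow> real \<Rightarrow> 'h \<Rightarrow> real \<Rightarrow> real measure"
  where "outcome_law K \<mu> \<beta> h a = distr (K (h, a)) borel (\<lambda>e. outcome \<mu> \<beta> (h, a, e))"

text \<open>\<open>E[(f(H\<^sub>t) - Y\<^sub>t\<^sub>+\<^sub>1)\<^sup>2 | H\<^sub>t = h, A\<^sub>t = a]\<close>\<close>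

definition cond_loss ::
    "('h \<times> real \<Rightarrow> real measure) \<Rightarrow> ('h \<Rightarrow> real) \<Rightarrow> real \<Rightarrow> ('h \<Rightarrow> real) \<Rightarrow> 'h \<Rightarrow> real \<Rightarrow> real"
  where "cond_loss K \<mu> \<beta> f h a = (\<integral>y. (f h - y)\<^sup>2 \<partial>outcome_law K \<mu> \<beta> h a)"

definition deployment_risk ::
    "'h measure \<Rightarrow> ('h \<times> real \<Rightarrow> real measure) \<Rightarrow> ('h \<Rightarrow> real) \<Rightarrow> real \<Rightarrow>
     ('h \<Rightarrow> real) \<Rightarrow> ('h \<Rightarrow> real) \<Rightarrow> real"
  where "deployment_risk P K \<mu> \<beta> f \<pi> = (\<integral>h. cond_loss K \<mu> \<beta> f h (\<pi> h) \<partial>P)"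

text \<open>
  Passive data: an infinite i.i.d. sample from the passive distribution. An estimator using \<open>n\<close>
  observations is one that depends on the first \<open>n\<close> coordinates only.
\<close>

definition passive_data ::
    "'h measure \<Rightarrow> ('h \<times> real \<Rightarrow> real measure) \<Rightarrow> ('h \<Rightarrow> real) \<Rightarrow> real \<Rightarrow> (nat \<Rightarrow> 'h \<times> real) measure"
  where "passive_data P K \<mu> \<beta> = (\<Pi>\<^sub>M i\<in>UNIV. passive_dist P K \<mu> \<beta>)"

definition estimators :: "'h measure \<Rightarrow> ((nat \<Rightarrow> 'h \<times> real) \<Rightarrow> real) set"
  where "estimators P = borel_measurable (\<Pi>\<^sub>M i\<in>UNIV. P \<Otimes>\<^sub>M borel)"

end

(*
  Since the passive action is 0, \<beta> drops out of the outcome pointwise, so the passive laws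
  coincide. Under deployment the risk is the second moment of (f - \<mu> - \<epsilon>) - \<beta> \<pi>, in which the
  coefficient of \<beta>^2 is E[\<pi>^2] > 0, so two feedback coefficients have different risks. A statistic
  of the passive data cannot converge to both risks under their common law.
*)

theory Submission
  imports Defs
begin

section \<open>Integration against a mixture of kernels\<close>

text \<open>Tonelli for a mixture \<open>M \<bind> K\<close>. Since \<open>f\<close> is nonnegative,
  a finite integral over the mixture forces almost every inner integral to be finite. This is what
  later turns the iterated integral defining the risk into one integral over the joint law.\<close>

lemma
  fixes f :: "'b \<Rightarrow> real"
  assumes K: "K \<in> M \<rightarrow>\<^sub>M subprob_algebra N"
    and f: "f \<in> borel_measurable N" and nonneg: "\<And>y. 0 \<le> f y"
    and int: "integrable (M \<bind> K) f"
  shows AE_integrable_kernel: "AE x in M. integrable (K x) f"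
    and integrable_kernel_integral: "integrable M (\<lambda>x. \<integral>y. f y \<partial>K x)"
    and integral_bind_nonneg: "(\<integral>x. (\<integral>y. f y \<partial>K x) \<partial>M) = (\<integral>y. f y \<partial>(M \<bind> K))"
proof -
  define F where "F = (\<lambda>x. \<integral>\<^sup>+y. ennreal (f y) \<partial>K x)"
  have F_meas: "F \<in> borel_measurable M"
    unfolding F_def using K f by measurable
  have F_int: "(\<integral>\<^sup>+x. F x \<partial>M) = (\<integral>\<^sup>+y. ennreal (f y) \<partial>(M \<bind> K))"
    unfolding F_def by (rule nn_integral_bind[OF _ K, symmetric]) (use f in measurable)
  have F_fin: "(\<integral>\<^sup>+x. F x \<partial>M) < \<infinity>"
    using int nonneg unfolding F_int integrable_iff_bounded by simp
  have f_K: "f \<in> borel_measurable (K x)" if "x \<in> space M" for x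
    using f measurable_cong_sets[OF sets_kernel[OF K that] refl] by blast
  have "AE x in M. F x \<noteq> \<infinity>"
    by (rule nn_integral_PInf_AE[OF F_meas]) (use F_fin in auto)
  then show ae: "AE x in M. integrable (K x) f"
    using AE_space
  proof eventually_elim
    case (elim x)
    then show ?case
      by (intro integrableI_nonneg f_K) (auto simp: F_def nonneg less_top)
  qed
  \<comment> \<open>Only an almost-everywhere identity: where \<open>f\<close> is not integrable for
    \<open>K x\<close>, the Bochner integral defaults to 0 while \<open>F x\<close> is
    infinite.\<close>
  have ae_eq: "AE x in M. ennreal (\<integral>y. f y \<partial>K x) = F x"
    using ae by eventually_elim (simp add: F_def nn_integral_eq_integral nonneg)
  have G_meas: "(\<lambda>x. \<integral>y. f y \<partial>K x) \<in> borel_measurable M"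
    using K f by measurable
  have G_int: "(\<integral>\<^sup>+x. ennreal (\<integral>y. f y \<partial>K x) \<partial>M) = (\<integral>\<^sup>+x. F x \<partial>M)"
    by (rule nn_integral_cong_AE[OF ae_eq])
  show "integrable M (\<lambda>x. \<integral>y. f y \<partial>K x)"
    by (rule integrableI_nonneg[OF G_meas]) (use G_int F_fin nonneg in simp_all)
  show "(\<integral>x. (\<integral>y. f y \<partial>K x) \<partial>M) = (\<integral>y. f y \<partial>(M \<bind> K))"
    using int nonneg
    by (simp add: integral_eq_nn_integral[OF G_meas] G_int F_int integral_eq_nn_integral)
qed

section \<open>Products and differences of square-integrable functions\<close>

lemma integrable_mult_of_squares:
  fixes f g :: "'a \<Rightarrow> real"
  assumes "f \<in> borel_measurable M" "g \<in> borel_measurable M"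
    and "integrable M (\<lambda>x. (f x)\<^sup>2)" "integrable M (\<lambda>x. (g x)\<^sup>2)"
  shows "integrable M (\<lambda>x. f x * g x)"
proof (rule Bochner_Integration.integrable_bound[OF Bochner_Integration.integrable_add[OF assms(3,4)]])
  show "AE x in M. norm (f x * g x) \<le> norm ((f x)\<^sup>2 + (g x)\<^sup>2)"
  proof (rule AE_I2)
    fix x
    have "2 * (\<bar>f x\<bar> * \<bar>g x\<bar>) \<le> (f x)\<^sup>2 + (g x)\<^sup>2"
      using sum_squares_bound[of "\<bar>f x\<bar>" "\<bar>g x\<bar>"] by simp
    moreover have "0 \<le> \<bar>f x\<bar> * \<bar>g x\<bar>" by simp
    ultimately have "\<bar>f x\<bar> * \<bar>g x\<bar> \<le> (f x)\<^sup>2 + (g x)\<^sup>2" by linarith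
    then show "norm (f x * g x) \<le> norm ((f x)\<^sup>2 + (g x)\<^sup>2)"
      by (simp add: abs_mult)
  qed
qed (use assms in measurable)

lemma integrable_diff_squared:
  fixes f g :: "'a \<Rightarrow> real"
  assumes "f \<in> borel_measurable M" "g \<in> borel_measurable M"
    and "integrable M (\<lambda>x. (f x)\<^sup>2)" "integrable M (\<lambda>x. (g x)\<^sup>2)"
  shows "integrable M (\<lambda>x. (f x - g x)\<^sup>2)"
  \<comment> \<open>Reassociation isolates the cross term as 2 times the product
    \<open>f x * g x\<close>, the form covered by \<open>integrable_mult_of_squares\<close>.\<close>
  unfolding power2_diff mult.assoc
  using assms by (intro Bochner_Integration.integrable_add Bochner_Integration.integrable_diff
      integrable_mult_right integrable_mult_of_squares)

section \<open>The feedback model\<close>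

text \<open>The coefficient \<beta> is an argument of the lemmas rather than a parameter of the
  locale, so laws and risks for two coefficients can be compared in one context.\<close>

locale feedback_model = prob_space P
  for P :: "'h measure" and K :: "'h \<times> real \<Rightarrow> real measure" +
  assumes kernel[measurable]: "K \<in> P \<Otimes>\<^sub>M borel \<rightarrow>\<^sub>M prob_algebra borel"
begin

section \<open>The joint law of history, action and noise\<close>

lemma regime_kernel:
  assumes [measurable]: "g \<in> borel_measurable P"
  shows "(\<lambda>h. distr (K (h, g h)) (P \<Otimes>\<^sub>M borel \<Otimes>\<^sub>M borel) (\<lambda>e. (h, g h, e)))
    \<in> P \<rightarrow>\<^sub>M prob_algebra (P \<Otimes>\<^sub>M borel \<Otimes>\<^sub>M borel)"
  by (rule measurable_distr_prob_space2[where M = borel]) measurable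

lemma P_in_prob_algebra: "P \<in> space (prob_algebra P)"
  by (simp add: space_prob_algebra prob_space_axioms)

lemma sets_regime:
  assumes "g \<in> borel_measurable P"
  shows "sets (regime P K g) = sets (P \<Otimes>\<^sub>M borel \<Otimes>\<^sub>M borel)"
  unfolding regime_def by (rule sets_bind'[OF P_in_prob_algebra regime_kernel[OF assms]])

lemma prob_space_regime:
  assumes "g \<in> borel_measurable P"
  shows "prob_space (regime P K g)"
  unfolding regime_def by (rule prob_space_bind'[OF P_in_prob_algebra regime_kernel[OF assms]])

lemma sets_K:
  assumes "h \<in> space P"
  shows "sets (K (h, a)) = sets borel"
  using measurable_space[OF kernel, of "(h, a)"] assms
  by (auto simp: space_pair_measure space_prob_algebra)

lemma prob_space_K:
  assumes "h \<in> space P"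
  shows "prob_space (K (h, a))"
  using measurable_space[OF kernel, of "(h, a)"] assms
  by (auto simp: space_pair_measure space_prob_algebra)

lemma measurable_regime_section:
  assumes "h \<in> space P"
  shows "(\<lambda>e. (h, a, e)) \<in> K (h, a) \<rightarrow>\<^sub>M P \<Otimes>\<^sub>M borel \<Otimes>\<^sub>M borel"
  using assms sets_K[OF assms, measurable_cong] by measurable

lemma
  fixes \<phi> :: "'h \<Rightarrow> real"
  assumes g: "g \<in> borel_measurable P"
    and \<phi>: "\<phi> \<in> borel_measurable P"
  shows integrable_regime_history:
      "integrable P \<phi> \<Longrightarrow> integrable (regime P K g) (\<lambda>w. \<phi> (fst w))"
    and integral_regime_history: "(\<integral>w. \<phi> (fst w) \<partial>regime P K g) = (\<integral>h. \<phi> h \<partial>P)"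
proof -
  have fst: "fst \<in> regime P K g \<rightarrow>\<^sub>M P"
    using sets_regime[OF g, measurable_cong] by measurable
  have P_eq: "distr (regime P K g) P fst = P"
  proof -
    have "distr (regime P K g) P fst =
        P \<bind> (\<lambda>h. distr (distr (K (h, g h)) (P \<Otimes>\<^sub>M borel \<Otimes>\<^sub>M borel) (\<lambda>e. (h, g h, e))) P fst)"
      unfolding regime_def
      by (rule distr_bind[OF measurable_prob_algebraD[OF regime_kernel[OF g]] not_empty measurable_fst])
    \<comment> \<open>Within a fibre the history is frozen at \<open>h\<close>, so its law is the
      point mass there; mixing point masses over \<open>P\<close> gives back
      \<open>P\<close>.\<close>
    also have "\<dots> = P \<bind> return P"
    proof (rule bind_cong[OF refl])
      fix h assume h: "h \<in> space P"
      have "distr (distr (K (h, g h)) (P \<Otimes>\<^sub>M borel \<Otimes>\<^sub>M borel) (\<lambda>e. (h, g h, e))) P fst =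
          distr (K (h, g h)) P (\<lambda>e. h)"
        using distr_distr[OF measurable_fst measurable_regime_section[OF h]] by (simp add: comp_def)
      also have "\<dots> = return P h"
        by (rule prob_space.distr_const[OF prob_space_K[OF h] h])
      finally show "distr (distr (K (h, g h)) (P \<Otimes>\<^sub>M borel \<Otimes>\<^sub>M borel) (\<lambda>e. (h, g h, e))) P fst =
        return P h" .
    qed
    also have "\<dots> = P" by (rule bind_return'') simp
    finally show ?thesis .
  qed
  show "integrable (regime P K g) (\<lambda>w. \<phi> (fst w))" if "integrable P \<phi>"
    using that integrable_distr_eq[OF fst \<phi>] P_eq by simp
  show "(\<integral>w. \<phi> (fst w) \<partial>regime P K g) = (\<integral>h. \<phi> h \<partial>P)"
    using integral_distr[OF fst \<phi>] P_eq by simp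
qed

text \<open>Each fibre law is a pushforward along \<open>e\<close> to \<open>(h, g h, e)\<close>,
  hence is carried by the graph of \<open>g\<close>.\<close>

lemma AE_regime_action:
  assumes g[measurable]: "g \<in> borel_measurable P"
  shows "AE w in regime P K g. fst (snd w) = g (fst w)"
  unfolding regime_def
proof (subst AE_bind[OF measurable_prob_algebraD[OF regime_kernel[OF g]]])
  show "AE h in P. AE w in distr (K (h, g h)) (P \<Otimes>\<^sub>M borel \<Otimes>\<^sub>M borel) (\<lambda>e. (h, g h, e)).
      fst (snd w) = g (fst w)"
  proof (rule AE_I2)
    fix h assume h: "h \<in> space P"
    show "AE w in distr (K (h, g h)) (P \<Otimes>\<^sub>M borel \<Otimes>\<^sub>M borel) (\<lambda>e. (h, g h, e)).
      fst (snd w) = g (fst w)"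
      by (subst AE_distr_iff[OF measurable_regime_section[OF h]]) auto
  qed
qed measurable

lemma outcome_measurable [measurable]:
  assumes [measurable]: "\<mu> \<in> borel_measurable P"
  shows "outcome \<mu> \<beta> \<in> borel_measurable (P \<Otimes>\<^sub>M borel \<Otimes>\<^sub>M borel)"
  unfolding outcome_def by measurable

text \<open>The action coordinate is almost surely 0 by \<open>AE_regime_action\<close>, so the term
  in \<beta> vanishes off a null set and the two pushforwards agree.\<close>

lemma passive_dist_eq:
  assumes \<mu>: "\<mu> \<in> borel_measurable P"
  shows "passive_dist P K \<mu> \<beta> = passive_dist P K \<mu> \<beta>'"
  unfolding passive_dist_def
proof (rule distr_cong_AE)
  note sets_regime[OF borel_measurable_const, measurable_cong]
  note [measurable] = \<mu>
  show "AE w in regime P K (\<lambda>_. 0). (fst w, outcome \<mu> \<beta> w) = (fst w, outcome \<mu> \<beta>' w)"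
    using AE_regime_action[OF borel_measurable_const]
    by eventually_elim (auto simp: outcome_def)
  show "(\<lambda>w. (fst w, outcome \<mu> \<beta> w)) \<in> regime P K (\<lambda>_. 0) \<rightarrow>\<^sub>M P \<Otimes>\<^sub>M borel" by measurable
  show "(\<lambda>w. (fst w, outcome \<mu> \<beta>' w)) \<in> regime P K (\<lambda>_. 0) \<rightarrow>\<^sub>M P \<Otimes>\<^sub>M borel" by measurable
qed simp_all

section \<open>The infinite passive sample\<close>

lemma passive_data_eq:
  assumes "\<mu> \<in> borel_measurable P"
  shows "passive_data P K \<mu> \<beta> = passive_data P K \<mu> \<beta>'"
  unfolding passive_data_def by (subst passive_dist_eq[OF assms, of \<beta> \<beta>']) (rule refl)

lemma prob_space_passive_data:
  assumes [measurable]: "\<mu> \<in> borel_measurable P"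
  shows "prob_space (passive_data P K \<mu> \<beta>)"
  unfolding passive_data_def passive_dist_def
proof (intro prob_space_PiM prob_space.prob_space_distr prob_space_regime)
  note sets_regime[OF borel_measurable_const, measurable_cong]
  show "(\<lambda>w. (fst w, outcome \<mu> \<beta> w)) \<in> regime P K (\<lambda>_. 0) \<rightarrow>\<^sub>M P \<Otimes>\<^sub>M borel" by measurable
qed simp

text \<open>Links \<open>estimators\<close>, which mentions only \<open>P\<close>, to measurability
  under the data law of every \<beta>.\<close>

lemma sets_passive_data:
  "sets (passive_data P K \<mu> \<beta>) = sets (\<Pi>\<^sub>M i\<in>UNIV. P \<Otimes>\<^sub>M borel)"
  unfolding passive_data_def by (rule sets_PiM_cong) (simp_all add: passive_dist_def)

end

section \<open>Deployment risk\<close>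

locale deployed_model = feedback_model P K
  for P :: "'h measure" and K :: "'h \<times> real \<Rightarrow> real measure" +
  fixes \<mu> f \<pi> :: "'h \<Rightarrow> real"
  assumes meas[measurable]:
      "\<mu> \<in> borel_measurable P" "f \<in> borel_measurable P" "\<pi> \<in> borel_measurable P"
    and second_moments: "integrable P (\<lambda>h. (\<mu> h)\<^sup>2)" "integrable P (\<lambda>h. (f h)\<^sup>2)"
      "integrable P (\<lambda>h. (\<pi> h)\<^sup>2)"
    and noise_second_moment: "integrable (regime P K \<pi>) (\<lambda>(h, a, e). e\<^sup>2)"
begin

abbreviation "R \<equiv> regime P K \<pi>"

lemmas sets_R[measurable_cong] = sets_regime[OF meas(3)]

text \<open>The part of the prediction error free of \<beta>: under deployment the error is almost
  surely this minus \<beta> times the policy.\<close>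

definition residual :: "'h \<times> real \<times> real \<Rightarrow> real"
  where "residual = (\<lambda>w. f (fst w) - \<mu> (fst w) - snd (snd w))"

lemma residual_measurable [measurable]: "residual \<in> borel_measurable R"
  unfolding residual_def by measurable

lemma residual_square_integrable: "integrable R (\<lambda>w. (residual w)\<^sup>2)"
  unfolding residual_def
proof (rule integrable_diff_squared)
  show "integrable R (\<lambda>w. (f (fst w) - \<mu> (fst w))\<^sup>2)"
    by (rule integrable_regime_history) (use second_moments in \<open>auto intro!: integrable_diff_squared\<close>)
  show "integrable R (\<lambda>w. (snd (snd w))\<^sup>2)"
    using noise_second_moment by (simp add: case_prod_unfold)
qed measurable

lemma policy_square_integrable: "integrable R (\<lambda>w. (\<pi> (fst w))\<^sup>2)"
  by (rule integrable_regime_history) (use second_moments in auto)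

text \<open>The action is read off the sample point through \<open>outcome\<close>, not computed
  from the history. This makes the loss a function on the whole product space, and the form in
  \<open>residual\<close> and \<open>\<pi>\<close> holds only almost surely.\<close>

definition loss :: "real \<Rightarrow> 'h \<times> real \<times> real \<Rightarrow> real"
  where "loss \<beta> = (\<lambda>w. (f (fst w) - outcome \<mu> \<beta> w)\<^sup>2)"

lemma loss_measurable: "loss \<beta> \<in> borel_measurable (P \<Otimes>\<^sub>M borel \<Otimes>\<^sub>M borel)"
  unfolding loss_def by measurable

lemma loss_measurable_R: "loss \<beta> \<in> borel_measurable R"
  using loss_measurable sets_R by (metis measurable_cong_sets)

lemma loss_AE: "AE w in R. loss \<beta> w = (residual w - \<beta> * \<pi> (fst w))\<^sup>2"
  using AE_regime_action[OF meas(3)]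
  by eventually_elim (auto simp: loss_def residual_def outcome_def case_prod_beta algebra_simps)

lemma loss_integrable: "integrable R (loss \<beta>)"
proof -
  have "integrable R (\<lambda>w. (residual w - \<beta> * \<pi> (fst w))\<^sup>2)"
    by (rule integrable_diff_squared)
      (auto simp: power_mult_distrib residual_square_integrable policy_square_integrable)
  then show ?thesis
    by (subst integrable_cong_AE[OF loss_measurable_R _ loss_AE]) auto
qed

lemma integral_loss:
  "(\<integral>w. loss \<beta> w \<partial>R) =
    (\<integral>h. (\<pi> h)\<^sup>2 \<partial>P) * \<beta>\<^sup>2 + (- 2 * (\<integral>w. residual w * \<pi> (fst w) \<partial>R)) * \<beta> + (\<integral>w. (residual w)\<^sup>2 \<partial>R)"
proof -
  have cross: "integrable R (\<lambda>w. residual w * \<pi> (fst w))"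
    by (rule integrable_mult_of_squares)
      (auto simp: residual_square_integrable policy_square_integrable)
  have "(\<integral>w. loss \<beta> w \<partial>R) = (\<integral>w. (residual w - \<beta> * \<pi> (fst w))\<^sup>2 \<partial>R)"
    by (rule integral_cong_AE[OF loss_measurable_R _ loss_AE]) measurable
  also have "\<dots> = (\<integral>w. \<beta>\<^sup>2 * (\<pi> (fst w))\<^sup>2 - 2 * \<beta> * (residual w * \<pi> (fst w)) + (residual w)\<^sup>2 \<partial>R)"
    by (rule Bochner_Integration.integral_cong) (auto simp: power2_eq_square algebra_simps)
  also have "\<dots> = \<beta>\<^sup>2 * (\<integral>w. (\<pi> (fst w))\<^sup>2 \<partial>R) - 2 * \<beta> * (\<integral>w. residual w * \<pi> (fst w) \<partial>R)
      + (\<integral>w. (residual w)\<^sup>2 \<partial>R)"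
    using cross residual_square_integrable policy_square_integrable by simp
  \<comment> \<open>The leading coefficient involves the history alone, whose marginal under
    \<open>R\<close> is \<open>P\<close>; it becomes the second moment that the theorem takes to be
    positive.\<close>
  also have "(\<integral>w. (\<pi> (fst w))\<^sup>2 \<partial>R) = (\<integral>h. (\<pi> h)\<^sup>2 \<partial>P)"
    by (rule integral_regime_history) auto
  finally show ?thesis by (simp add: algebra_simps)
qed

lemma
  assumes h: "h \<in> space P"
  shows integrable_section_iff:
      "integrable (distr (K (h, \<pi> h)) (P \<Otimes>\<^sub>M borel \<Otimes>\<^sub>M borel) (\<lambda>e. (h, \<pi> h, e))) (loss \<beta>) \<longleftrightarrow>
       integrable (outcome_law K \<mu> \<beta> h (\<pi> h)) (\<lambda>y. (f h - y)\<^sup>2)"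
    and integral_section:
      "(\<integral>w. loss \<beta> w \<partial>distr (K (h, \<pi> h)) (P \<Otimes>\<^sub>M borel \<Otimes>\<^sub>M borel) (\<lambda>e. (h, \<pi> h, e))) =
       cond_loss K \<mu> \<beta> f h (\<pi> h)"
proof -
  have outcome: "(\<lambda>e. outcome \<mu> \<beta> (h, \<pi> h, e)) \<in> borel_measurable (K (h, \<pi> h))"
    by (rule measurable_compose[OF measurable_regime_section[OF h] outcome_measurable[OF meas(1)]])
  show "integrable (distr (K (h, \<pi> h)) (P \<Otimes>\<^sub>M borel \<Otimes>\<^sub>M borel) (\<lambda>e. (h, \<pi> h, e))) (loss \<beta>) \<longleftrightarrow>
      integrable (outcome_law K \<mu> \<beta> h (\<pi> h)) (\<lambda>y. (f h - y)\<^sup>2)"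
    unfolding outcome_law_def
    \<comment> \<open>Both measures are images of \<open>K (h, \<pi> h)\<close>, and both integrands
      pull back to the same function of the noise.\<close>
    by (subst (1 2) integrable_distr_eq)
      (auto simp: measurable_regime_section[OF h] loss_measurable outcome loss_def)
  show "(\<integral>w. loss \<beta> w \<partial>distr (K (h, \<pi> h)) (P \<Otimes>\<^sub>M borel \<Otimes>\<^sub>M borel) (\<lambda>e. (h, \<pi> h, e))) =
      cond_loss K \<mu> \<beta> f h (\<pi> h)"
    unfolding cond_loss_def outcome_law_def
    by (subst (1 2) integral_distr)
      (auto simp: measurable_regime_section[OF h] loss_measurable outcome loss_def)
qed

text \<open>Disintegration of \<open>R\<close> over the history: the finite joint integral of
  \<open>loss\<close> yields almost sure finiteness of the conditional losses, their integrability,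
  and the risk as a single integral.\<close>

lemma
  shows cond_loss_well_defined:
      "AE h in P. integrable (outcome_law K \<mu> \<beta> h (\<pi> h)) (\<lambda>y. (f h - y)\<^sup>2)"
    and cond_loss_integrable: "integrable P (\<lambda>h. cond_loss K \<mu> \<beta> f h (\<pi> h))"
    and deployment_risk_eq: "deployment_risk P K \<mu> \<beta> f \<pi> = (\<integral>w. loss \<beta> w \<partial>R)"
proof -
  note kernel' = measurable_prob_algebraD[OF regime_kernel[OF meas(3)]]
  note fubini_prems = kernel' loss_measurable[of \<beta>] _ loss_integrable[of \<beta>, unfolded regime_def]
  have nonneg: "0 \<le> loss \<beta> w" for w
    by (simp add: loss_def)
  show "AE h in P. integrable (outcome_law K \<mu> \<beta> h (\<pi> h)) (\<lambda>y. (f h - y)\<^sup>2)"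
    using AE_integrable_kernel[OF fubini_prems, OF nonneg] AE_space
    by eventually_elim (simp add: integrable_section_iff)
  show "integrable P (\<lambda>h. cond_loss K \<mu> \<beta> f h (\<pi> h))"
    using integrable_kernel_integral[OF fubini_prems, OF nonneg]
    by (simp add: integral_section cong: Bochner_Integration.integrable_cong)
  show "deployment_risk P K \<mu> \<beta> f \<pi> = (\<integral>w. loss \<beta> w \<partial>R)"
    using integral_bind_nonneg[OF fubini_prems, OF nonneg]
    by (simp add: deployment_risk_def regime_def integral_section
        cong: Bochner_Integration.integral_cong)
qed

end

section \<open>Non-identifiability\<close>

lemma nonconstant_quadratic:
  fixes a b c :: real
  assumes "a \<noteq> 0"
  shows "\<exists>x y. a * x\<^sup>2 + b * x + c \<noteq> a * y\<^sup>2 + b * y + c"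
proof (rule ccontr)
  assume "\<not> ?thesis"
  then have eq: "a * x\<^sup>2 + b * x + c = c" for x
    by (metis mult_zero_right power_zero_numeral add_0)
  \<comment> \<open>The values at 1 and -1 give \<open>a + b = 0\<close> and
    \<open>a - b = 0\<close>, hence \<open>a = 0\<close>.\<close>
  from eq[of 1] eq[of "-1"] assms show False by simp
qed

lemma (in prob_space) not_AE_eq_two_constants:
  assumes "AE x in M. T x = r" "AE x in M. T x = s"
  shows "r = s"
proof -
  have "AE x in M. r = s" using assms by eventually_elim simp
  then show ?thesis by simp
qed

lemma (in prob_space) limit_in_probability_unique:
  fixes T :: "nat \<Rightarrow> 'a \<Rightarrow> real"
  assumes T: "\<And>n. T n \<in> borel_measurable M"
    and r: "\<And>\<delta>. \<delta> > 0 \<Longrightarrow> (\<lambda>n. prob {x \<in> space M. \<bar>T n x - r\<bar> \<ge> \<delta>}) \<longlonglongrightarrow> 0"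
    and s: "\<And>\<delta>. \<delta> > 0 \<Longrightarrow> (\<lambda>n. prob {x \<in> space M. \<bar>T n x - s\<bar> \<ge> \<delta>}) \<longlonglongrightarrow> 0"
  shows "r = s"
proof (rule ccontr)
  assume "r \<noteq> s"
  \<comment> \<open>At half the distance between the two limits, every value of \<open>T n\<close>
    is at least \<open>\<delta>\<close> away from one of them, so the two deviation events cover the
    space. Their probabilities sum to at least 1 yet tend to 0.\<close>
  define \<delta> where "\<delta> = \<bar>r - s\<bar> / 2"
  have "\<delta> > 0" using \<open>r \<noteq> s\<close> by (simp add: \<delta>_def)
  define A where "A t n = {x \<in> space M. \<bar>T n x - t\<bar> \<ge> \<delta>}" for t n
  have A: "A t n \<in> events" for t n
    unfolding A_def using T[of n] by measurable
  have "1 \<le> prob (A r n) + prob (A s n)" for n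
  proof -
    have "space M \<subseteq> A r n \<union> A s n"
    proof
      fix x assume "x \<in> space M"
      moreover have "2 * \<delta> \<le> \<bar>T n x - r\<bar> + \<bar>T n x - s\<bar>"
        by (simp add: \<delta>_def)
      then have "\<delta> \<le> \<bar>T n x - r\<bar> \<or> \<delta> \<le> \<bar>T n x - s\<bar>"
        by linarith
      ultimately show "x \<in> A r n \<union> A s n" by (auto simp: A_def)
    qed
    then have "1 \<le> prob (A r n \<union> A s n)"
      using finite_measure_mono[of "space M" "A r n \<union> A s n"] A prob_space by auto
    also have "\<dots> \<le> prob (A r n) + prob (A s n)"
      by (rule measure_Un_le[OF A A])
    finally show ?thesis .
  qed
  moreover have "(\<lambda>n. prob (A r n) + prob (A s n)) \<longlonglongrightarrow> 0 + 0"
    unfolding A_def by (intro tendsto_add r s \<open>\<delta> > 0\<close>)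
  ultimately have "(1::real) \<le> 0 + 0"
    by (intro LIMSEQ_le_const) auto
  then show False by simp
qed

theorem theorem1:
  fixes P :: "'h measure"
    and K :: "'h \<times> real \<Rightarrow> real measure"
    and \<mu> f \<pi> :: "'h \<Rightarrow> real"
  assumes history_law: "prob_space P"
    and noise_kernel: "K \<in> P \<Otimes>\<^sub>M borel \<rightarrow>\<^sub>M prob_algebra borel"
    and meas: "\<mu> \<in> borel_measurable P" "f \<in> borel_measurable P" "\<pi> \<in> borel_measurable P"
    and second_moments: "integrable P (\<lambda>h. (\<mu> h)\<^sup>2)" "integrable P (\<lambda>h. (f h)\<^sup>2)"
      "integrable P (\<lambda>h. (\<pi> h)\<^sup>2)"
    and noise_passive: "centered_noise P K (\<lambda>_. 0)"
    and noise_deployed: "centered_noise P K \<pi>"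
    and active: "(\<integral>h. (\<pi> h)\<^sup>2 \<partial>P) > 0"
  shows
    \<comment> \<open>all feedback coefficients induce the same passive distribution\<close>
    "(\<forall>\<beta> \<beta>'. passive_dist P K \<mu> \<beta> = passive_dist P K \<mu> \<beta>') \<and>
    \<comment> \<open>the deployment risk is well defined\<close>
     (\<forall>\<beta>. (AE h in P. integrable (outcome_law K \<mu> \<beta> h (\<pi> h)) (\<lambda>y. (f h - y)\<^sup>2)) \<and>
          integrable P (\<lambda>h. cond_loss K \<mu> \<beta> f h (\<pi> h))) \<and>
    \<comment> \<open>and a nonconstant quadratic function of the feedback coefficient\<close>
     (\<exists>a b c. a \<noteq> 0 \<and> (\<forall>\<beta>. deployment_risk P K \<mu> \<beta> f \<pi> = a * \<beta>\<^sup>2 + b * \<beta> + c)) \<and>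
     \<not> (\<lambda>\<beta>. deployment_risk P K \<mu> \<beta> f \<pi>) constant_on UNIV \<and>
    \<comment> \<open>it is not a functional of the passive distribution\<close>
     \<not> (\<exists>\<Phi>. \<forall>\<beta>. \<Phi> (passive_dist P K \<mu> \<beta>) = deployment_risk P K \<mu> \<beta> f \<pi>) \<and>
    \<comment> \<open>no estimator based on passive data recovers it for all feedback coefficients\<close>
     \<not> (\<exists>T\<in>estimators P. \<forall>\<beta>. AE x in passive_data P K \<mu> \<beta>.
          T x = deployment_risk P K \<mu> \<beta> f \<pi>) \<and>
    \<comment> \<open>and no sequence of such estimators is consistent for all feedback coefficients\<close>
     \<not> (\<exists>T. (\<forall>n::nat. T n \<in> estimators P) \<and>
          (\<forall>\<beta>. \<forall>\<delta>>0. (\<lambda>n. measure (passive_data P K \<mu> \<beta>)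
             {x \<in> space (passive_data P K \<mu> \<beta>). \<bar>T n x - deployment_risk P K \<mu> \<beta> f \<pi>\<bar> \<ge> \<delta>})
             \<longlonglongrightarrow> 0))"
  proof -
  interpret deployed_model P K \<mu> f \<pi>
    by (intro deployed_model.intro feedback_model.intro feedback_model_axioms.intro
        deployed_model_axioms.intro history_law noise_kernel meas second_moments
        noise_deployed[unfolded centered_noise_def, THEN conjunct1])
  let ?risk = "\<lambda>\<beta>. deployment_risk P K \<mu> \<beta> f \<pi>"
  obtain a b c where "a \<noteq> 0" and quadratic: "\<And>\<beta>. ?risk \<beta> = a * \<beta>\<^sup>2 + b * \<beta> + c"
  proof
    show "(\<integral>h. (\<pi> h)\<^sup>2 \<partial>P) \<noteq> 0" using active by simp
  \<comment> \<open>Unification with \<open>integral_loss\<close> fixes the other witnesses: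
    \<open>b\<close> is -2 times the cross moment of residual and policy, \<open>c\<close> the
    second moment of the residual.\<close>
  qed (rule trans[OF deployment_risk_eq integral_loss])
  obtain \<beta> \<beta>' where neq: "?risk \<beta> \<noteq> ?risk \<beta>'"
    using nonconstant_quadratic[OF \<open>a \<noteq> 0\<close>] unfolding quadratic by blast
  note dist_eq = passive_dist_eq[OF meas(1)]
  \<comment> \<open>Oriented to rewrite the law for \<open>\<beta>'\<close> into the law for
    \<open>\<beta>\<close>, the one interpreted as a probability space below.\<close>
  note data_eq = passive_data_eq[OF meas(1), of \<beta>' \<beta>]
  interpret data: prob_space "passive_data P K \<mu> \<beta>"
    by (rule prob_space_passive_data[OF meas(1)])
  show ?thesis
  proof (intro conjI)
    show "\<forall>\<beta> \<beta>'. passive_dist P K \<mu> \<beta> = passive_dist P K \<mu> \<beta>'"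
      using dist_eq by blast
    show "\<forall>\<beta>. (AE h in P. integrable (outcome_law K \<mu> \<beta> h (\<pi> h)) (\<lambda>y. (f h - y)\<^sup>2)) \<and>
        integrable P (\<lambda>h. cond_loss K \<mu> \<beta> f h (\<pi> h))"
      using cond_loss_well_defined cond_loss_integrable by blast
    show "\<exists>a b c. a \<noteq> 0 \<and> (\<forall>\<beta>. ?risk \<beta> = a * \<beta>\<^sup>2 + b * \<beta> + c)"
      using \<open>a \<noteq> 0\<close> quadratic by blast
    show "\<not> ?risk constant_on UNIV"
      using neq unfolding constant_on_def by (metis UNIV_I)
    show "\<not> (\<exists>\<Phi>. \<forall>\<beta>. \<Phi> (passive_dist P K \<mu> \<beta>) = ?risk \<beta>)"
      using neq dist_eq by metis
    show "\<not> (\<exists>T\<in>estimators P. \<forall>\<beta>. AE x in passive_data P K \<mu> \<beta>. T x = ?risk \<beta>)"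
    proof (intro notI, elim bexE)
      fix T assume "\<forall>\<beta>. AE x in passive_data P K \<mu> \<beta>. T x = ?risk \<beta>"
      \<comment> \<open>After rewriting, \<open>T\<close> equals two different constants almost
        surely under one probability law.\<close>
      from this[rule_format, of \<beta>] this[rule_format, of \<beta>'] have "?risk \<beta> = ?risk \<beta>'"
        unfolding data_eq by (rule data.not_AE_eq_two_constants)
      with neq show False by contradiction
    qed
    show "\<not> (\<exists>T. (\<forall>n::nat. T n \<in> estimators P) \<and>
        (\<forall>\<beta>. \<forall>\<delta>>0. (\<lambda>n. measure (passive_data P K \<mu> \<beta>)
           {x \<in> space (passive_data P K \<mu> \<beta>). \<bar>T n x - ?risk \<beta>\<bar> \<ge> \<delta>}) \<longlonglongrightarrow> 0))"
    proof (intro notI, elim exE conjE)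
      fix T :: "nat \<Rightarrow> (nat \<Rightarrow> 'h \<times> real) \<Rightarrow> real"
      assume T: "\<forall>n. T n \<in> estimators P"
        and lim: "\<forall>\<beta>. \<forall>\<delta>>0. (\<lambda>n. measure (passive_data P K \<mu> \<beta>)
           {x \<in> space (passive_data P K \<mu> \<beta>). \<bar>T n x - ?risk \<beta>\<bar> \<ge> \<delta>}) \<longlonglongrightarrow> 0"
      have "T n \<in> borel_measurable (passive_data P K \<mu> \<beta>)" for n
        using T measurable_cong_sets[OF sets_passive_data refl] unfolding estimators_def by blast
      then have "?risk \<beta> = ?risk \<beta>'"
        by (rule data.limit_in_probability_unique[where T = T])
          (use lim[rule_format, of _ \<beta>] lim[rule_format, of _ \<beta>'] data_eq in simp_all)
      with neq show False by contradiction
    qed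
  qed
qed

end
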